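(* There exists a digraph $D=\langle V,E\rangle$ with countable vertex set $V$ such that $N(u)$ is finite for every $u\in V$ and for every finite set $A\subseteq V$ there exists a vertex $u\in V$ with $N(u)=A$. In particular, $D$ is strongly extensive.
   Context: A digraph is $D=\langle V,E\rangle$ with $V$ a nonempty set and $E\subseteq V\times V$. $N(u)=\{v\in V:\langle v,u\rangle\in E\}$ is the set of in-neighbors of $u$. $D$ is strongly extensive if for every vertex $u\in V$ and every set $A\subseteq N(u)$ there exists a vertex $v\in V$ such that $N(v)=A$. "Countable" here means infinite countable. *)

theory Defs
  imports "Graph_Theory.Pair_Digraph" "HOL-Library.Countable_Set"
begin

text \<open>
  A digraph is a nonempty vertex set together with an arbitrary set of ordered pairs of
  vertices; loops are allowed and infinite vertex sets are allowed. The Graph_Theory locale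
  \<open>pair_wf_digraph\<close> states exactly \<open>E \<subseteq> V \<times> V\<close> and leaves out nonemptiness.
\<close>

definition nonempty_digraph :: "'a pair_pre_digraph \<Rightarrow> bool" where
  "nonempty_digraph D \<longleftrightarrow> pair_wf_digraph D \<and> pverts D \<noteq> {}"

definition in_neighbors :: "'a pair_pre_digraph \<Rightarrow> 'a \<Rightarrow> 'a set" where
  "in_neighbors D u = {v \<in> pverts D. (v, u) \<in> parcs D}"

definition strongly_extensive :: "'a pair_pre_digraph \<Rightarrow> bool" where
  "strongly_extensive D \<longleftrightarrow>
     (\<forall>u \<in> pverts D. \<forall>A. A \<subseteq> in_neighbors D u \<longrightarrow> (\<exists>v \<in> pverts D. in_neighbors D v = A))"

end

theory Submission
  imports Defs "HOL-Library.Nat_Bijection"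
begin

text \<open>
  Ackermann's coding: let the in-neighbors of \<open>n\<close> be the positions of the ones in its binary
  expansion, so that in-neighborhoods biject with the finite sets of naturals.
\<close>

theorem proposition6p5:
  shows "\<exists>D :: nat pair_pre_digraph.
    nonempty_digraph D \<and>
    countable (pverts D) \<and> infinite (pverts D) \<and>
    (\<forall>u \<in> pverts D. finite (in_neighbors D u)) \<and>
    (\<forall>A. A \<subseteq> pverts D \<and> finite A \<longrightarrow> (\<exists>u \<in> pverts D. in_neighbors D u = A)) \<and>
    strongly_extensive D"
proof -
  define D :: "nat pair_pre_digraph"
    where "D = \<lparr>pverts = UNIV, parcs = {(m, n). m \<in> set_decode n}\<rparr>"
  have verts: "pverts D = UNIV"
    by (simp add: D_def)
  have nbrs: "in_neighbors D n = set_decode n" for n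
    by (simp add: in_neighbors_def D_def)
  have wf: "nonempty_digraph D"
    by (auto simp: nonempty_digraph_def D_def intro: pair_wf_digraph.intro)
  \<comment> \<open>The witness is \<open>set_encode A\<close>, the sum of \<open>2 ^ k\<close> over
    \<open>k\<close> in \<open>A\<close>. For infinite \<open>A\<close> that sum defaults to 0, so
    \<open>set_decode\<close> recovers only finite sets.\<close>
  have realized: "\<exists>n. in_neighbors D n = A" if "finite A" for A
    using that by (metis nbrs set_encode_inverse)
  \<comment> \<open>A natural number has finitely many binary ones, so every subset of an
    in-neighborhood is finite and \<open>realized\<close> supplies its vertex.\<close>
  have "strongly_extensive D"
    unfolding strongly_extensive_def verts
    using realized by (metis UNIV_I finite_set_decode finite_subset nbrs)
  with wf realized show ?thesis
    by (intro exI[of _ D]) (simp add: verts nbrs)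
qed

end
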